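(* Let $n\geqslant1$ be an integer and $s\in(0,1)$. There exist a bounded open set $\Omega\subset\mathbb{R}^n_+$ and an $x_1$-antisymmetric function $u:\mathbb{R}^n\to\mathbb{R}$ that is non-negative and $s$-harmonic in $\Omega$, is equal to zero at a point in $\Omega$, but is not identically zero in $\Omega$.
   Context: $\mathbb{R}^n_+=\{x\in\mathbb{R}^n : x_1>0\}$. For $s\in(0,1)$ the fractional Laplacian is $$(-\Delta)^s u(x)=c_{n,s}\,\mathrm{P.V.}\int_{\mathbb{R}^n}\frac{u(x)-u(y)}{|x-y|^{n+2s}}\,dy,$$ where P.V. is the Cauchy principal value (limit as $\varepsilon\to0^+$ of the integral over $\mathbb{R}^n\setminus B_\varepsilon(x)$) and $c_{n,s}=\frac{s4^s\Gamma(\frac{n+2s}{2})}{\Gamma(1-s)}>0$ is a normalisation constant. A (measurable) function $u$ is $s$-harmonic in an open set $U$ if $(-\Delta)^su$ is well defined and equal to $0$ at every point of $U$. A function $u:\mathbb{R}^n\to\mathbb{R}$ is $x_1$-antisymmetric if $u(-x_1,x_2,\dots,x_n)=-u(x_1,x_2,\dots,x_n)$ for all $x\in\mathbb{R}^n$. *)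

theory Defs
  imports "HOL-Analysis.Analysis"
begin

text \<open>Euclidean n-space is \<^typ>\<open>real ^ 'n\<close>, with n the cardinality of the index type. A bare finite
  index type has no first element, so the index \<open>k\<close> that plays the role of the first coordinate
  is an explicit parameter.\<close>

definition half_space :: "'n::finite \<Rightarrow> (real ^ 'n) set"
  where "half_space k = {x. x $ k > 0}"

definition reflect :: "'n::finite \<Rightarrow> real ^ 'n \<Rightarrow> real ^ 'n"
  where "reflect k x = (\<chi> i. if i = k then - (x $ i) else x $ i)"

definition antisymmetric :: "'n::finite \<Rightarrow> (real ^ 'n \<Rightarrow> real) \<Rightarrow> bool"
  where "antisymmetric k u \<longleftrightarrow> (\<forall>x. u (reflect k x) = - u x)"

definition frac_const :: "nat \<Rightarrow> real \<Rightarrow> real"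
  where "frac_const n s = s * 4 powr s * Gamma ((real n + 2 * s) / 2) / Gamma (1 - s)"

definition frac_integrand :: "real \<Rightarrow> (real ^ 'n::finite \<Rightarrow> real) \<Rightarrow> real ^ 'n \<Rightarrow> real ^ 'n \<Rightarrow> real"
  where "frac_integrand s u x y = (u x - u y) / norm (x - y) powr (real CARD('n) + 2 * s)"

definition frac_truncated :: "real \<Rightarrow> (real ^ 'n::finite \<Rightarrow> real) \<Rightarrow> real ^ 'n \<Rightarrow> real \<Rightarrow> real"
  where "frac_truncated s u x \<epsilon> =
    set_lebesgue_integral lebesgue (- ball x \<epsilon>) (frac_integrand s u x)"

text \<open>The Bochner integral of a non-integrable function is 0 by convention, so integrability of
  every truncation has to be required along with existence of the finite limit.\<close>

definition frac_laplacian_defined :: "real \<Rightarrow> (real ^ 'n::finite \<Rightarrow> real) \<Rightarrow> real ^ 'n \<Rightarrow> bool"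
  where "frac_laplacian_defined s u x \<longleftrightarrow>
    (\<forall>\<epsilon>>0. set_integrable lebesgue (- ball x \<epsilon>) (frac_integrand s u x)) \<and>
    (\<exists>L. (frac_truncated s u x \<longlongrightarrow> L) (at_right 0))"

definition frac_laplacian :: "real \<Rightarrow> (real ^ 'n::finite \<Rightarrow> real) \<Rightarrow> real ^ 'n \<Rightarrow> real"
  where "frac_laplacian s u x = frac_const CARD('n) s * Lim (at_right 0) (frac_truncated s u x)"

definition s_harmonic_on :: "real \<Rightarrow> (real ^ 'n::finite \<Rightarrow> real) \<Rightarrow> (real ^ 'n) set \<Rightarrow> bool"
  where "s_harmonic_on s u U \<longleftrightarrow>
    u \<in> borel_measurable lebesgue \<and>
    (\<forall>x\<in>U. frac_laplacian_defined s u x \<and> frac_laplacian s u x = 0)"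

end

theory Submission
  imports Defs "HOL-Real_Asymp.Real_Asymp"
begin

text \<open>
  The function sought depends on the coordinate \<open>x\<^sub>k\<close> alone, \<open>u x = \<phi> (x $ k)\<close> with \<open>\<phi>\<close> odd, so
  the problem becomes one about functions of one real variable: it suffices that \<open>\<phi>\<close> is non-negative
  and not identically zero on an interval \<open>(x\<^sub>0, x\<^sub>1)\<close> of positive numbers, touches zero inside it,
  and is s-harmonic there. The set \<open>\<Omega>\<close> is then a piece of a slab.

  \<^bold>\<open>From n dimensions to one.\<close> Folding the truncated integral along \<open>z \<mapsto> -z\<close> turns it into an
  integral of the second difference \<open>2 \<phi> x - \<phi> (x + t) - \<phi> (x - t)\<close>, \<open>t = z $ k\<close>, against
  \<open>|z| powr - (n + 2 s)\<close> over the part of the half space outside a ball. The image of this kernel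
  under \<open>z \<mapsto> z $ k\<close> is homogeneous, hence a multiple of \<open>t powr (-1 - 2 s) dt\<close>
  (\<open>distr_component_norm_powr\<close>). Therefore the fractional Laplacian of \<open>u\<close> vanishes as soon as the
  second difference is absolutely integrable against \<open>t powr (-1 - 2 s)\<close> on the positive axis with
  integral zero (\<open>s_harmonic_at_component\<close>); this condition is linear in \<open>\<phi>\<close> and invariant under
  translations and reflections.

  \<^bold>\<open>Enough explicit solutions.\<close> The power \<open>max 0 t powr s\<close> of the positive part satisfies it at every
  positive point (\<open>balanced_second_difference_pos_powr\<close>), and by homogeneity only the point 1 matters.
  There the inversion \<open>y \<mapsto> 1 / y\<close> carries the integral over \<open>y > 1\<close> to one over \<open>0 < y < 1\<close>, where
  the total integrand is the derivative of \<open>(1 - y powr s)\<^sup>2 / (2 s (1 - y) powr (2 s))\<close>; its integral,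
  \<open>- 1 / (2 s)\<close>, cancels the contribution of \<open>y < 0\<close>. Hence the odd functions
  \<open>w\<^sub>A x = max 0 (A + x) powr s - max 0 (A - x) powr s\<close> are s-harmonic on \<open>(-A, A)\<close>.

  \<^bold>\<open>A combination touching zero.\<close> As \<open>x\<close> increases to \<open>A\<close> the derivative of \<open>w\<^sub>A\<close> blows up whereas
  \<open>w\<^sub>B\<close> is smooth at \<open>A\<close> for \<open>A < B\<close>, so the Wronskian of the two tends to infinity. Using this
  twice, with \<open>A < 1 < 2\<close>, the quotient \<open>(w\<^sub>A + c w\<^sub>2) / w\<^sub>1\<close> can be made strictly decreasing at some
  \<open>x\<^sub>0\<close> and strictly increasing at some later \<open>x\<^sub>1 < A\<close>. It attains its minimum \<open>m\<close> over
  \<open>[x\<^sub>0, x\<^sub>1]\<close> at an interior point, and \<open>\<phi> = w\<^sub>A + c w\<^sub>2 - m w\<^sub>1\<close> is as required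
  (\<open>exists_touching_combination\<close>).
\<close>

section \<open>The image of the fractional kernel under a coordinate\<close>

text \<open>On the dyadic shell \<open>e 2\<^sup>j \<le> |z| < e 2\<^sup>j\<^sup>+\<^sup>1\<close> the integrand is at most \<open>(e 2\<^sup>j) powr - (n + a)\<close> and
  the volume is of order \<open>(e 2\<^sup>j)\<^sup>n\<close>, so the shells contribute a geometric series of ratio
  \<open>2 powr - a\<close>.\<close>
lemma integrable_norm_powr_outside_ball:
  fixes a e :: real
  assumes a: "0 < a" and e: "0 < e"
  shows "integrable lborel
    (\<lambda>z::'a::euclidean_space. indicator (- ball 0 e) z * norm z powr - (real DIM('a) + a))"
    (is "integrable _ ?f")
proof (rule integrableI_bounded)
  let ?n = "real DIM('a)" and ?V = "unit_ball_vol (real DIM('a))"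
  \<comment> \<open>The whole ball of the outer radius replaces the shell: its volume is known and the loss is a
    constant factor.\<close>
  define g where "g j z = indicator (ball 0 (e * 2 ^ Suc j)) z * (e * 2 ^ j) powr - (?n + a)"
    for j :: nat and z :: 'a
  have g_nonneg: "0 \<le> g j z" for j z by (simp add: g_def)
  have le: "ennreal (norm (?f z)) \<le> (\<Sum>j. ennreal (g j z))" for z
  proof (cases "norm z < e")
    case False
    define j where "j = (LEAST j. norm z < e * 2 ^ Suc j)"
    obtain i where "norm z / e < 2 ^ i"
      using real_arch_pow[of 2 "norm z / e"] by auto
    also have "(2::real) ^ i \<le> 2 ^ Suc i" by simp
    finally have "norm z < e * 2 ^ Suc i" using e by (simp add: field_simps)
    then have j1: "norm z < e * 2 ^ Suc j" unfolding j_def by (rule LeastI)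
    have j2: "e * 2 ^ j \<le> norm z"
    proof (cases j)
      case (Suc i)
      then have "\<not> norm z < e * 2 ^ Suc i"
        unfolding j_def by (metis lessI not_less_Least)
      then show ?thesis using Suc by simp
    qed (use False in simp)
    have "norm (?f z) \<le> (e * 2 ^ j) powr - (?n + a)"
      using False e a j2 by (simp add: powr_mono2')
    also have "\<dots> = g j z" using j1 by (simp add: g_def)
    finally have "ennreal (norm (?f z)) \<le> ennreal (g j z)" by (rule ennreal_leI)
    also have "\<dots> \<le> (\<Sum>j. ennreal (g j z))"
      using sum_le_suminf[of "\<lambda>j. ennreal (g j z)" "{j}"] by simp
    finally show ?thesis .
  qed simp
  have int_g: "(\<integral>\<^sup>+z. ennreal (g j z) \<partial>lborel) = ennreal (?V * 2 ^ DIM('a) * e powr - a * (2 powr - a) ^ j)" for j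
  proof -
    have "(\<integral>\<^sup>+z. ennreal (g j z) \<partial>lborel)
        = (\<integral>\<^sup>+z. ennreal ((e * 2 ^ j) powr - (?n + a)) * indicator (ball 0 (e * 2 ^ Suc j)) (z::'a) \<partial>lborel)"
      by (intro nn_integral_cong) (simp add: g_def indicator_def)
    also have "\<dots> = ennreal ((e * 2 ^ j) powr - (?n + a)) * ennreal (?V * (e * 2 ^ Suc j) ^ DIM('a))"
      using e by (subst nn_integral_cmult_indicator) (simp_all add: emeasure_ball)
    also have "\<dots> = ennreal ((e * 2 ^ j) powr - (?n + a) * (?V * (e * 2 ^ Suc j) ^ DIM('a)))"
      using e by (simp add: ennreal_mult)
    also have "(e * 2 ^ j) powr - (?n + a) * (?V * (e * 2 ^ Suc j) ^ DIM('a))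
        = ?V * 2 ^ DIM('a) * ((e * 2 ^ j) powr ?n * (e * 2 ^ j) powr - (?n + a))"
      using e by (subst powr_realpow) (simp_all add: power_mult_distrib)
    also have "(e * 2 ^ j) powr ?n * (e * 2 ^ j) powr - (?n + a) = (e * 2 ^ j) powr - a"
      by (simp flip: powr_add)
    also have "\<dots> = e powr - a * (2 powr - a) ^ j"
      using e by (simp add: powr_mult powr_powr powr_realpow[symmetric] mult.commute)
    finally show ?thesis by (simp add: mult.assoc)
  qed
  have "summable (\<lambda>j. ?V * 2 ^ DIM('a) * e powr - a * (2 powr - a) ^ j)"
  proof (intro summable_mult summable_geometric)
    show "norm (2 powr - a :: real) < 1" using a powr_less_mono[of "-a" 0 2] by simp
  qed
  then have fin: "(\<Sum>j. ennreal (?V * 2 ^ DIM('a) * e powr - a * (2 powr - a) ^ j)) < \<infinity>"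
    by (simp add: ennreal_suminf_neq_top less_top[symmetric])
  have "(\<integral>\<^sup>+z. ennreal (norm (?f z)) \<partial>lborel) \<le> (\<integral>\<^sup>+z. (\<Sum>j. ennreal (g j z)) \<partial>lborel)"
    by (intro nn_integral_mono le)
  also have "\<dots> = (\<Sum>j. \<integral>\<^sup>+z. ennreal (g j z) \<partial>lborel)"
    by (rule nn_integral_suminf)
       (auto simp: g_def intro!: borel_measurable_times borel_measurable_indicator)
  also have "\<dots> < \<infinity>" using fin by (simp add: int_g)
  finally show "(\<integral>\<^sup>+z. ennreal (norm (?f z)) \<partial>lborel) < \<infinity>" .
qed simp

lemma nn_integral_powr_tail:
  fixes b x :: real
  assumes b: "0 < b" and x: "0 < x"
  shows "(\<integral>\<^sup>+t. ennreal (t powr (-1 - b)) * indicator {x<..} t \<partial>lborel) = ennreal (x powr - b / b)"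
proof -
  have "(\<integral>\<^sup>+t. ennreal (t powr (-1 - b)) * indicator {x<..} t \<partial>lborel)
      = (\<integral>\<^sup>+t. ennreal (t powr (-1 - b)) * indicator {x..} t \<partial>lborel)"
    by (intro nn_integral_cong_AE AE_I[where N="{x}"]) (auto simp: indicator_def)
  also have "\<dots> = ennreal (0 - (- (x powr - b / b)))"
  proof (rule nn_integral_FTC_atLeast)
    show "((\<lambda>t. - (t powr - b / b)) \<longlongrightarrow> 0) at_top"
      using b by real_asymp
    show "((\<lambda>t. - (t powr - b / b)) has_real_derivative t powr (-1 - b)) (at t)" if "x \<le> t" for t
      unfolding minus_diff_commute[of 1 b]
      using b x that by (auto intro!: derivative_eq_intros)
  qed (use x in auto)
  finally show ?thesis by simp
qed

text \<open>For \<open>x > 0\<close> both measures give \<open>{x<..}\<close> a mass proportional to \<open>x powr - b\<close>, the first one by the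
  substitution \<open>z \<mapsto> x z\<close>; so no integration over the remaining coordinates is needed. That \<open>\<kappa>\<close> is
  finite comes from the integrability of the kernel away from the origin.\<close>
lemma distr_component_norm_powr:
  fixes b :: real and k :: "'n::finite"
  assumes b: "0 < b"
  shows "\<exists>\<kappa>\<ge>0. distr (density lborel (\<lambda>z::real^'n.
      ennreal (indicator {z. 0 < z $ k} z * norm z powr - (real CARD('n) + b)))) borel (\<lambda>z. z $ k)
    = density lborel (\<lambda>t. ennreal (\<kappa> * (indicator {0<..} t * t powr (-1 - b))))"
proof -
  let ?n = "real CARD('n)"
  let ?w = "\<lambda>z::real^'n. norm z powr - (?n + b)"
  define T where "T x = (\<integral>\<^sup>+z. ennreal (?w z) * indicator {z. x < z $ k} z \<partial>lborel)" for x
  have "T 1 \<le> (\<integral>\<^sup>+z. ennreal (indicator (- ball 0 1) z * ?w z) \<partial>lborel)"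
    unfolding T_def
  proof (intro nn_integral_mono)
    fix z :: "real^'n"
    have "1 \<le> norm z" if "1 < z $ k"
      using that component_le_norm_cart[of z k] by linarith
    then show "ennreal (?w z) * indicator {z. 1 < z $ k} z \<le> ennreal (indicator (- ball 0 1) z * ?w z)"
      by (auto simp: indicator_def)
  qed
  also have "\<dots> < \<infinity>"
    using integrable_norm_powr_outside_ball[where 'a="real^'n", OF b zero_less_one]
    by (subst (asm) integrable_iff_bounded) (simp add: less_top)
  finally have "T 1 < \<infinity>" .
  then obtain \<kappa> where \<kappa>: "0 \<le> \<kappa>" "T 1 = ennreal \<kappa>" by (cases "T 1") auto
  have T: "T x = ennreal (\<kappa> * x powr - b)" if x: "0 < x" for x
  proof -
    have "T x = (\<integral>\<^sup>+z. ennreal (?w z) * indicator {z. x < z $ k} z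
        \<partial>density (distr lborel borel (\<lambda>z. 0 + x *\<^sub>R z)) (\<lambda>_. \<bar>x\<bar> ^ DIM(real^'n)))"
      unfolding T_def using lborel_affine[of x "0::real^'n"] x by simp
    also have "\<dots> = (\<integral>\<^sup>+z. ennreal (x ^ CARD('n)) * (ennreal (?w (x *\<^sub>R z)) * indicator {z. x < z $ k} (x *\<^sub>R z)) \<partial>lborel)"
      using x by (subst nn_integral_density) (simp_all add: nn_integral_distr)
    also have "\<dots> = (\<integral>\<^sup>+z. ennreal (x powr - b) * (ennreal (?w z) * indicator {z. 1 < z $ k} z) \<partial>lborel)"
    proof (intro nn_integral_cong)
      fix z :: "real^'n"
      have "x ^ CARD('n) * ?w (x *\<^sub>R z) = x powr - b * ?w z"
        using x by (simp add: powr_mult powr_realpow[symmetric] mult.assoc[symmetric] powr_add[symmetric])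
      then have "ennreal (x ^ CARD('n)) * ennreal (?w (x *\<^sub>R z)) = ennreal (x powr - b) * ennreal (?w z)"
        using x by (simp add: ennreal_mult[symmetric])
      moreover have "indicator {z. x < z $ k} (x *\<^sub>R z) = (indicator {z. 1 < z $ k} z :: ennreal)"
        using x by (simp add: indicator_def)
      ultimately show "ennreal (x ^ CARD('n)) * (ennreal (?w (x *\<^sub>R z)) * indicator {z. x < z $ k} (x *\<^sub>R z))
          = ennreal (x powr - b) * (ennreal (?w z) * indicator {z. 1 < z $ k} z)"
        by (simp add: mult.assoc[symmetric])
    qed
    also have "\<dots> = ennreal (x powr - b) * T 1"
      unfolding T_def by (rule nn_integral_cmult) simp
    finally show ?thesis using \<kappa> by (simp add: ennreal_mult mult.commute)
  qed
  define M where "M = distr (density lborel (\<lambda>z::real^'n.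
      ennreal (indicator {z. 0 < z $ k} z * ?w z))) borel (\<lambda>z. z $ k)"
  define N where "N = density lborel (\<lambda>t. ennreal ((\<kappa> * b) * (indicator {0<..} t * t powr (-1 - b))))"
  have sets_MN [measurable_cong, simp]: "sets M = sets borel" "sets N = sets borel"
    and space_MN [simp]: "space M = UNIV" "space N = UNIV"
    by (simp_all add: M_def N_def)
  have M: "emeasure M {x<..} = ennreal (\<kappa> * x powr - b)" if x: "0 < x" for x
  proof -
    have "emeasure M {x<..} = (\<integral>\<^sup>+z. ennreal (indicator {z. 0 < z $ k} z * ?w z) * indicator {z. x < z $ k} z \<partial>lborel)"
      unfolding M_def
      by (subst emeasure_distr) (simp_all add: emeasure_density vimage_def)
    also have "\<dots> = T x"
      unfolding T_def using x by (intro nn_integral_cong) (auto simp: indicator_def)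
    finally show ?thesis using T x by simp
  qed
  have N: "emeasure N {x<..} = ennreal (\<kappa> * x powr - b)" if x: "0 < x" for x
  proof -
    have "emeasure N {x<..} = (\<integral>\<^sup>+t. ennreal (\<kappa> * b) * (ennreal (t powr (-1 - b)) * indicator {x<..} t) \<partial>lborel)"
      unfolding N_def using x b \<kappa>
      by (subst emeasure_density) (auto intro!: nn_integral_cong simp: indicator_def ennreal_mult)
    also have "\<dots> = ennreal (\<kappa> * b) * ennreal (x powr - b / b)"
      by (simp add: nn_integral_cmult nn_integral_powr_tail[OF b x])
    finally show ?thesis using \<kappa> b by (simp add: ennreal_mult[symmetric])
  qed
  \<comment> \<open>The rays \<open>{x<..}\<close> with \<open>x \<le> 0\<close> have infinite mass, so the masses of rays do not identify
    the measures as they stand. The involution \<open>t \<mapsto> - (1 / t)\<close>, increasing on the positive axis, moves the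
    singularity from 0 to minus infinity, after which every ray has finite mass.\<close>
  let ?r = "\<lambda>t::real. - (1 / t)"
  have neg: "emeasure M {..0} = 0" "emeasure N {..0} = 0"
    unfolding M_def N_def
    by (auto simp: emeasure_distr emeasure_density vimage_def nn_integral_0_iff_AE
          intro!: AE_I2 split: split_indicator)
  have r: "emeasure (distr L borel ?r) {x<..} = (if x < 0 then emeasure L {- (1 / x)<..} else 0)"
    if L: "sets L = sets borel" "emeasure L {..0} = 0" for L x
  proof -
    have [measurable_cong]: "sets L = sets borel" by (rule L)
    have sp: "space L = UNIV" using sets_eq_imp_space_eq[OF L(1)] by simp
    have dst: "emeasure (distr L borel ?r) {x<..} = emeasure L {t. x < ?r t}"
      by (subst emeasure_distr) (simp_all add: sp vimage_def)
    have null: "{..0} \<in> null_sets L" using L by (simp add: null_sets_def)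
    have "emeasure L {t. x < ?r t} = emeasure L ({t. x < ?r t} - {..0})"
      using null by (intro emeasure_Diff_null_set[symmetric]) (simp_all add: L)
    also have "{t. x < ?r t} - {..0} = (if x < 0 then {- (1 / x)<..} else {})"
    proof -
      have 1: "x < ?r t \<longleftrightarrow> x < 0 \<and> - (1 / x) < t" if "0 < t" for t
      proof (cases "x < 0")
        case False
        moreover have "0 < 1 / t" using that by simp
        ultimately show ?thesis by linarith
      qed (use that in \<open>auto simp: field_simps\<close>)
      have 2: "0 < t" if "x < 0" "- (1 / x) < t" for t
        using that by (metis divide_neg_pos less_trans neg_0_less_iff_less divide_pos_neg zero_less_one)
      show ?thesis
      proof (rule set_eqI)
        show "t \<in> {t. x < ?r t} - {..0} \<longleftrightarrow> t \<in> (if x < 0 then {- (1 / x)<..} else {})" for t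
          using 1[of t] 2[of t] by (cases "0 < t") auto
      qed
    qed
    finally show ?thesis using dst by simp
  qed
  have "distr M borel ?r = distr N borel ?r"
    by (rule measure_eqI_lessThan) (auto simp: r neg M N)
  then have "distr (distr M borel ?r) borel ?r = distr (distr N borel ?r) borel ?r" by simp
  then have "distr M borel (\<lambda>t. t) = distr N borel (\<lambda>t. t)"
    by (simp add: distr_distr comp_def)
  then have "M = N" by (simp add: distr_id2)
  then show ?thesis
    using \<kappa> b unfolding M_def N_def by (intro exI[of _ "\<kappa> * b"]) auto
qed

section \<open>Reduction of the fractional Laplacian to second differences\<close>

text \<open>For \<open>0 < s < 1\<close> this says that the one-dimensional fractional Laplacian of \<open>\<phi>\<close> at \<open>x\<close> vanishes, the
  principal value being replaced by an absolutely convergent integral of the second difference.\<close>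
definition balanced_second_difference :: "real \<Rightarrow> (real \<Rightarrow> real) \<Rightarrow> real \<Rightarrow> bool"
  where "balanced_second_difference s \<phi> x \<longleftrightarrow>
    set_integrable lborel {0<..} (\<lambda>t. (2 * \<phi> x - \<phi> (x + t) - \<phi> (x - t)) * t powr (-1 - 2 * s)) \<and>
    (LBINT t:{0<..}. (2 * \<phi> x - \<phi> (x + t) - \<phi> (x - t)) * t powr (-1 - 2 * s)) = 0"

lemma lborel_eq_distr_uminus: "lborel = distr lborel borel (uminus :: 'a \<Rightarrow> 'a::euclidean_space)"
  using lborel_affine[of "-1" "0::'a"] by (simp add: density_1)

text \<open>With the singularity symmetrised the integrand is integrable over the whole half space, so the
  principal value is a limit by dominated convergence, and the limit is a multiple of the vanishing
  integral of the second difference. The growth bound makes each truncation integrable, as \<open>s < 2 s\<close>.\<close>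
lemma s_harmonic_at_component:
  fixes s C :: real and k :: "'n::finite" and x :: "real ^ 'n"
  assumes s: "0 < s"
    and [measurable]: "\<phi> \<in> borel_measurable borel"
    and growth: "\<And>t. \<bar>\<phi> t\<bar> \<le> C * (1 + \<bar>t\<bar>) powr s"
    and bal: "balanced_second_difference s \<phi> (x $ k)"
  shows "frac_laplacian_defined s (\<lambda>y. \<phi> (y $ k)) x \<and> frac_laplacian s (\<lambda>y. \<phi> (y $ k)) x = 0"
proof -
  define \<psi> where "\<psi> t = \<phi> (x $ k) - \<phi> (x $ k + t)" for t
  define d where "d t = 2 * \<phi> (x $ k) - \<phi> (x $ k + t) - \<phi> (x $ k - t)" for t
  define w where "w z = norm z powr - (real CARD('n) + 2 * s)" for z :: "real^'n"
  define F where "F e z = indicator (- ball 0 e) z * (\<psi> (z $ k) * w z)" for e and z :: "real^'n"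
  have [measurable]: "\<psi> \<in> borel_measurable borel" "d \<in> borel_measurable borel"
      "w \<in> borel_measurable borel"
    by (simp_all add: \<psi>_def[abs_def] d_def[abs_def] w_def[abs_def])
  have [measurable]: "ball (0::real^'n) e \<in> sets borel" for e by simp
  have [measurable]: "F e \<in> borel_measurable borel" for e
    unfolding F_def[abs_def] by simp

  \<comment> \<open>Outside the ball, \<open>1 + |z $ k|\<close> is at most a constant times \<open>|z|\<close>, so the integrand is
    dominated by a multiple of \<open>|z| powr - (n + s)\<close>.\<close>
  have F_int: "integrable lborel (F e)" if e: "0 < e" for e
  proof -
    define K where "K = \<bar>\<phi> (x $ k)\<bar> + C * (1 + \<bar>x $ k\<bar>) powr s"
    have "0 \<le> C" using growth[of 0] by simp
    then have "0 \<le> K" by (simp add: K_def)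
    have \<psi>_le: "\<bar>\<psi> t\<bar> \<le> K * (1 + \<bar>t\<bar>) powr s" for t
    proof -
      have "(1 + \<bar>x $ k + t\<bar>) powr s \<le> ((1 + \<bar>x $ k\<bar>) * (1 + \<bar>t\<bar>)) powr s"
        using s abs_triangle_ineq[of "x $ k" t] mult_nonneg_nonneg[of "\<bar>x $ k\<bar>" "\<bar>t\<bar>"]
        by (intro powr_mono2) (auto simp: algebra_simps simp del: mult_nonneg_nonneg)
      also have "\<dots> = (1 + \<bar>x $ k\<bar>) powr s * (1 + \<bar>t\<bar>) powr s" by (simp add: powr_mult)
      finally have "C * (1 + \<bar>x $ k + t\<bar>) powr s \<le> C * ((1 + \<bar>x $ k\<bar>) powr s * (1 + \<bar>t\<bar>) powr s)"
        using \<open>0 \<le> C\<close> by (rule mult_left_mono)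
      then have "\<bar>\<phi> (x $ k + t)\<bar> \<le> C * (1 + \<bar>x $ k\<bar>) powr s * (1 + \<bar>t\<bar>) powr s"
        using growth[of "x $ k + t"] by simp
      moreover have "\<bar>\<phi> (x $ k)\<bar> * 1 \<le> \<bar>\<phi> (x $ k)\<bar> * (1 + \<bar>t\<bar>) powr s"
        using s by (intro mult_left_mono ge_one_powr_ge_zero) auto
      ultimately show ?thesis unfolding \<psi>_def K_def distrib_right by linarith
    qed
    have "integrable lborel (\<lambda>z::real^'n. K * (1 / e + 1) powr s *
        (indicator (- ball 0 e) z * norm z powr - (real DIM(real^'n) + s)))"
      by (intro integrable_mult_right integrable_norm_powr_outside_ball s e)
    then show ?thesis
    proof (rule Bochner_Integration.integrable_bound)
      show "AE z in lborel. norm (F e z) \<le> norm (K * (1 / e + 1) powr s *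
          (indicator (- ball 0 e) z * norm z powr - (real DIM(real^'n) + s)))"
      proof (rule AE_I2)
        fix z :: "real^'n"
        show "norm (F e z) \<le> norm (K * (1 / e + 1) powr s *
            (indicator (- ball 0 e) z * norm z powr - (real DIM(real^'n) + s)))"
        proof (cases "e \<le> norm z")
          case True
          then have "1 + \<bar>z $ k\<bar> \<le> (1 / e + 1) * norm z"
            using component_le_norm_cart[of z k] e
            by (simp add: distrib_right add_mono)
          then have "(1 + \<bar>z $ k\<bar>) powr s \<le> ((1 / e + 1) * norm z) powr s"
            using s by (intro powr_mono2) auto
          also have "\<dots> = (1 / e + 1) powr s * norm z powr s"
            using e by (simp add: powr_mult)
          finally have "\<bar>\<psi> (z $ k)\<bar> \<le> K * ((1 / e + 1) powr s * norm z powr s)"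
            using \<psi>_le[of "z $ k"] \<open>0 \<le> K\<close> by (meson mult_left_mono order_trans)
          then have "\<bar>\<psi> (z $ k)\<bar> * w z \<le> K * ((1 / e + 1) powr s * norm z powr s) * w z"
            by (rule mult_right_mono) (simp add: w_def)
          also have "\<dots> = K * (1 / e + 1) powr s * (norm z powr s * norm z powr - (real CARD('n) + 2 * s))"
            by (simp add: w_def)
          also have "norm z powr s * norm z powr - (real CARD('n) + 2 * s) = norm z powr - (real CARD('n) + s)"
            by (simp add: minus_diff_commute[of s] flip: powr_add)
          finally show ?thesis
            using True \<open>0 \<le> K\<close> by (simp add: F_def abs_mult w_def)
        qed (simp add: F_def)
      qed
    qed simp
  qed

  have shift: "indicator (- ball x e) y *\<^sub>R frac_integrand s (\<lambda>y. \<phi> (y $ k)) x y = F e (- x + y)" for e y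
  proof -
    have "indicator (- ball x e) y = (indicator (- ball 0 e) (- x + y) :: real)"
      by (auto simp: indicator_def dist_norm norm_minus_commute)
    moreover have "norm (x - y) = norm (- x + y)" by (metis norm_minus_commute uminus_add_conv_diff)
    moreover have "w (- x + y) = 1 / norm (- x + y) powr (real CARD('n) + 2 * s)"
      unfolding w_def by (rule powr_minus_divide)
    ultimately show ?thesis
      by (simp add: F_def \<psi>_def frac_integrand_def del: add_uminus_conv_diff uminus_add_conv_diff)
  qed
  have lborel_shift: "distr lborel borel ((+) (- x)) = lborel" by (rule lborel_distr_plus)
  have int_shift: "integrable lborel (\<lambda>y. F e (- x + y))" if "0 < e" for e
    using F_int[OF that] by (subst (asm) lborel_shift[symmetric]) (simp add: integrable_distr_eq)
  have trunc: "frac_truncated s (\<lambda>y. \<phi> (y $ k)) x e = (\<integral>z. F e z \<partial>lborel)" for e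
  proof -
    have "frac_truncated s (\<lambda>y. \<phi> (y $ k)) x e = (\<integral>y. F e (- x + y) \<partial>lborel)"
      unfolding frac_truncated_def set_lebesgue_integral_def shift
      by (rule integral_completion) simp
    also have "\<dots> = (\<integral>z. F e z \<partial>lborel)"
      by (subst (2) lborel_shift[symmetric]) (simp add: integral_distr)
    finally show ?thesis .
  qed
  have defd: "set_integrable lebesgue (- ball x e) (frac_integrand s (\<lambda>y. \<phi> (y $ k)) x)" if "0 < e" for e
    unfolding set_integrable_def shift
    using int_shift[OF that] by (subst integrable_completion) simp_all

  define W where "W z = indicator {z. 0 < z $ k} z * w z" for z :: "real^'n"
  have [measurable]: "W \<in> borel_measurable borel" unfolding W_def[abs_def] by simp
  obtain \<kappa> where \<kappa>: "0 \<le> \<kappa>" and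
    push: "distr (density lborel (\<lambda>z. ennreal (W z))) borel (\<lambda>z. z $ k)
      = density lborel (\<lambda>t. ennreal (\<kappa> * (indicator {0<..} t * t powr (-1 - 2 * s))))"
    using distr_component_norm_powr[of "2 * s" k] s unfolding W_def w_def by auto
  have W_nonneg: "0 \<le> W z" for z by (simp add: W_def w_def)
  have d_int: "integrable lborel (\<lambda>t. indicator {0<..} t *\<^sub>R (d t * t powr (-1 - 2 * s)))"
      "(\<integral>t. indicator {0<..} t *\<^sub>R (d t * t powr (-1 - 2 * s)) \<partial>lborel) = 0"
    using bal unfolding balanced_second_difference_def set_integrable_def set_lebesgue_integral_def d_def
    by simp_all
  have eq1: "(\<lambda>t. (\<kappa> * (indicator {0<..} t * t powr (-1 - 2 * s))) *\<^sub>R d t)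
      = (\<lambda>t. \<kappa> * (indicator {0<..} t *\<^sub>R (d t * t powr (-1 - 2 * s))))"
    by (auto simp: fun_eq_iff)
  have "integrable lborel (\<lambda>t. (\<kappa> * (indicator {0<..} t * t powr (-1 - 2 * s))) *\<^sub>R d t)"
    unfolding eq1 using d_int by (intro integrable_mult_right) simp
  then have "integrable (distr (density lborel (\<lambda>z. ennreal (W z))) borel (\<lambda>z. z $ k)) d"
    unfolding push using \<kappa> by (subst integrable_density) simp_all
  then have Wd_int: "integrable lborel (\<lambda>z. W z * d (z $ k))"
    using W_nonneg by (simp add: integrable_distr_eq integrable_density)
  have "(\<integral>z. W z * d (z $ k) \<partial>lborel) = integral\<^sup>L (distr (density lborel (\<lambda>z. ennreal (W z))) borel (\<lambda>z. z $ k)) d"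
    using W_nonneg by (simp add: integral_distr integral_density)
  also have "\<dots> = (\<integral>t. \<kappa> * (indicator {0<..} t *\<^sub>R (d t * t powr (-1 - 2 * s))) \<partial>lborel)"
    unfolding push eq1[symmetric] using \<kappa> by (subst integral_density) simp_all
  also have "\<dots> = 0"
    using d_int by simp
  finally have Wd_zero: "(\<integral>z. W z * d (z $ k) \<partial>lborel) = 0" .

  \<comment> \<open>The hyperplane \<open>z $ k = 0\<close> can be dropped because \<open>\<psi> 0 = 0\<close>; the other half space is mapped onto
    this one by \<open>z \<mapsto> -z\<close>, and \<open>\<psi> t + \<psi> (- t) = d t\<close>.\<close>
  have fold: "(\<integral>z. F e z \<partial>lborel) = (\<integral>z. indicator (- ball 0 e) z * (W z * d (z $ k)) \<partial>lborel)" if e: "0 < e" for e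
  proof -
    let ?P = "\<lambda>z. indicator {z. 0 < z $ k} z * F e z" and ?N = "\<lambda>z. indicator {z. z $ k < 0} z * F e z"
    have P: "integrable lborel ?P" and N: "integrable lborel ?N"
      using F_int[OF e] by (auto intro!: integrable_real_mult_indicator simp: mult.commute)
    have N': "integrable lborel (\<lambda>z. ?N (- z))"
      using N by (subst (asm) lborel_eq_distr_uminus) (simp add: integrable_distr_eq)
    have "F e z = ?P z + ?N z" for z
      by (auto simp: F_def \<psi>_def indicator_def not_less)
    then have "(\<integral>z. F e z \<partial>lborel) = (\<integral>z. ?P z + ?N z \<partial>lborel)"
      by (intro Bochner_Integration.integral_cong) auto
    also have "\<dots> = (\<integral>z. ?P z \<partial>lborel) + (\<integral>z. ?N z \<partial>lborel)"
      using P N by (rule Bochner_Integration.integral_add)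
    also have "(\<integral>z. ?N z \<partial>lborel) = (\<integral>z. ?N (- z) \<partial>lborel)"
      by (subst lborel_eq_distr_uminus) (simp add: integral_distr)
    also have "(\<integral>z. ?P z \<partial>lborel) + (\<integral>z. ?N (- z) \<partial>lborel) = (\<integral>z. ?P z + ?N (- z) \<partial>lborel)"
      using P N' by (rule Bochner_Integration.integral_add[symmetric])
    also have "(\<lambda>z. ?P z + ?N (- z)) = (\<lambda>z. indicator (- ball 0 e) z * (W z * d (z $ k)))"
      by (auto simp: fun_eq_iff F_def W_def w_def \<psi>_def d_def indicator_def algebra_simps)
    finally show ?thesis .
  qed
  have "(frac_truncated s (\<lambda>y. \<phi> (y $ k)) x \<longlongrightarrow> 0) (at_right 0)"
  proof (rule tendsto_at_right_sequentially[of 0 1])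
    fix S :: "nat \<Rightarrow> real" assume S: "\<And>n. 0 < S n" "S \<longlonglongrightarrow> 0"
    have "(\<lambda>i. \<integral>z. indicator (- ball 0 (S i)) z * (W z * d (z $ k)) \<partial>lborel)
        \<longlonglongrightarrow> (\<integral>z. W z * d (z $ k) \<partial>lborel)"
    proof (rule integral_dominated_convergence[where w="\<lambda>z. norm (W z * d (z $ k))"])
      show "AE z in lborel. (\<lambda>i. indicator (- ball 0 (S i)) z * (W z * d (z $ k))) \<longlonglongrightarrow> W z * d (z $ k)"
      proof (rule AE_I2)
        fix z :: "real^'n"
        show "(\<lambda>i. indicator (- ball 0 (S i)) z * (W z * d (z $ k))) \<longlonglongrightarrow> W z * d (z $ k)"
        proof (cases "z = 0")
          case False
          then have "\<forall>\<^sub>F i in sequentially. S i < norm z"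
            using S(2) by (intro order_tendstoD) auto
          then have "\<forall>\<^sub>F i in sequentially. indicator (- ball 0 (S i)) z * (W z * d (z $ k)) = W z * d (z $ k)"
            by eventually_elim simp
          then show ?thesis by (rule tendsto_eventually)
        qed (simp add: W_def)
      qed
      show "integrable lborel (\<lambda>z. norm (W z * d (z $ k)))"
        using Wd_int by (rule integrable_norm)
    qed (auto simp: indicator_def)
    then show "(\<lambda>i. frac_truncated s (\<lambda>y. \<phi> (y $ k)) x (S i)) \<longlonglongrightarrow> 0"
      using S by (simp add: trunc fold Wd_zero)
  qed simp
  then show ?thesis
    using defd tendsto_Lim[OF trivial_limit_at_right_real]
    unfolding frac_laplacian_defined_def frac_laplacian_def by auto
qed

section \<open>Powers of the positive part\<close>

lemma balanced_second_difference_linear: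
  assumes "balanced_second_difference s \<phi> x" "balanced_second_difference s \<psi> x"
  shows "balanced_second_difference s (\<lambda>t. a * \<phi> t + b * \<psi> t) x"
proof -
  let ?D = "\<lambda>\<phi> t. (2 * \<phi> x - \<phi> (x + t) - \<phi> (x - t)) * t powr (-1 - 2 * s)"
  have eq: "?D (\<lambda>t. a * \<phi> t + b * \<psi> t) = (\<lambda>t. a * ?D \<phi> t + b * ?D \<psi> t)"
    by (auto simp: fun_eq_iff algebra_simps)
  have "set_integrable lborel {0<..} (?D \<phi>)" "(LBINT t:{0<..}. ?D \<phi> t) = 0"
    "set_integrable lborel {0<..} (?D \<psi>)" "(LBINT t:{0<..}. ?D \<psi> t) = 0"
    using assms by (auto simp: balanced_second_difference_def)
  then show ?thesis
    unfolding balanced_second_difference_def eq by simp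
qed

lemma balanced_second_difference_translate:
  "balanced_second_difference s (\<lambda>t. \<phi> (a + t)) x \<longleftrightarrow> balanced_second_difference s \<phi> (a + x)"
  by (simp add: balanced_second_difference_def algebra_simps)

lemma balanced_second_difference_reflect:
  "balanced_second_difference s (\<lambda>t. \<phi> (a - t)) x \<longleftrightarrow> balanced_second_difference s \<phi> (a - x)"
  by (simp add: balanced_second_difference_def algebra_simps)

abbreviation pos_powr :: "real \<Rightarrow> real \<Rightarrow> real"
  where "pos_powr s t \<equiv> max 0 t powr s"

text \<open>Concavity of \<open>y \<mapsto> y powr s\<close>, obtained from convexity of the exponential at \<open>s ln y\<close>.\<close>
lemma powr_le_tangent_at_1:
  fixes s y :: real
  assumes "0 < s" "s < 1" "0 \<le> y"
  shows "y powr s \<le> 1 + s * (y - 1)"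
proof (cases "y = 0")
  case False
  have "exp ((1 - s) *\<^sub>R 0 + s *\<^sub>R ln y) \<le> (1 - s) * exp 0 + s * exp (ln y)"
    using assms by (intro convex_onD[OF exp_convex]) auto
  then show ?thesis using assms False by (simp add: powr_def algebra_simps)
qed (use assms in simp)

text \<open>Joining the two conclusions of the fundamental theorem for non-negative integrands lets one
  verification of the hypotheses serve both.\<close>
lemma nonneg_FTC:
  fixes f F :: "real \<Rightarrow> real" and a b :: ereal
  assumes "a < b"
    and "\<And>x. a < ereal x \<Longrightarrow> ereal x < b \<Longrightarrow> (F has_real_derivative f x) (at x)"
    and "\<And>x. a < ereal x \<Longrightarrow> ereal x < b \<Longrightarrow> isCont f x"
    and "AE x in lborel. a < ereal x \<longrightarrow> ereal x < b \<longrightarrow> 0 \<le> f x"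
    and "((F \<circ> real_of_ereal) \<longlongrightarrow> A) (at_right a)"
    and "((F \<circ> real_of_ereal) \<longlongrightarrow> B) (at_left b)"
  shows "set_integrable lborel (einterval a b) f \<and> (LBINT x=a..b. f x) = B - A"
  using interval_integral_FTC_nonneg[OF assms] by blast

text \<open>The second difference splits as \<open>p - q\<close>, one part for each side of the point 1. The parts \<open>p\<close> and
  \<open>q\<close> have no elementary antiderivatives in general, but inverting \<open>y = 1 + t\<close> to \<open>1 / y = 1 - \<delta> t\<close> with
  \<open>\<delta> t = t / (1 + t)\<close> relates them: if \<open>R\<close> is an antiderivative of \<open>p\<close>, then \<open>t \<mapsto> R (\<delta> t) + E t\<close> is one
  of \<open>q\<close>, with the elementary \<open>E\<close> defined below. So the integral of \<open>p - q\<close> telescopes to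
  boundary values in which the unknown \<open>R\<close> cancels. The axis is cut at \<open>t = 1\<close> so that
  every integrand has a sign, which makes its integrability a consequence of the boundary limits:
  \<open>p - q \<ge> 0\<close> before 1 by concavity, and \<open>p\<close> and \<open>q\<close> are separately non-negative after 1.\<close>
lemma balanced_second_difference_pos_powr_at_1:
  assumes s: "0 < s" "s < 1"
  shows "balanced_second_difference s (pos_powr s) 1"
proof -
  define p where "p t = (1 - pos_powr s (1 - t)) * t powr (-1 - 2 * s)" for t
  define q where "q t = ((1 + t) powr s - 1) * t powr (-1 - 2 * s)" for t :: real
  define \<delta> where "\<delta> t = t / (1 + t)" for t :: real
  define E where "E t = ((1 + t) powr s - 1)\<^sup>2 * t powr (- 2 * s) / (2 * s)" for t :: real
  have cont_p: "isCont p t" if "0 < t" for t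
    unfolding p_def using that s by (intro continuous_intros) auto
  have cont_q: "isCont q t" if "0 < t" for t
    unfolding q_def using that s by (intro continuous_intros) auto
  have "\<exists>R. \<forall>t::real. 0 < ereal t \<longrightarrow> ereal t < \<infinity> \<longrightarrow> (R has_vector_derivative p t) (at t)"
    using cont_p by (intro einterval_antiderivative) auto
  then obtain R where R: "(R has_real_derivative p t) (at t)" if "0 < t" for t
    by (auto simp: has_real_derivative_iff_has_vector_derivative)
  define \<Psi> where "\<Psi> t = R (\<delta> t) + E t" for t

  have \<Psi>: "(\<Psi> has_real_derivative q t) (at t)" if t: "0 < t" for t
  proof -
    have "(\<delta> has_real_derivative 1 / (1 + t)\<^sup>2) (at t)"
      unfolding \<delta>_def using t
      by (auto intro!: derivative_eq_intros simp: field_simps power2_eq_square)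
    moreover have "(R has_real_derivative p (\<delta> t)) (at (\<delta> t))"
      using t by (intro R) (simp add: \<delta>_def)
    ultimately have 1: "((\<lambda>t. R (\<delta> t)) has_real_derivative p (\<delta> t) * (1 / (1 + t)\<^sup>2)) (at t)"
      by (rule DERIV_chain2[rotated])
    have 2: "(E has_real_derivative
        ((1 + t) powr s - 1) * t powr (-1 - 2 * s) * (1 - (1 + t) powr (s - 1))) (at t)"
    proof -
      have "(E has_real_derivative
        (2 * ((1 + t) powr s - 1) * (s * (1 + t) powr (s - 1)) * t powr (- 2 * s)
          + ((1 + t) powr s - 1)\<^sup>2 * ((- 2 * s) * t powr (- 2 * s - 1))) / (2 * s)) (at t)"
        unfolding E_def using t s
        by (auto intro!: derivative_eq_intros simp: field_simps)
      moreover have "t powr (- 2 * s) = t * t powr (-1 - 2 * s)" "t powr (- 2 * s - 1) = t powr (-1 - 2 * s)"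
        using t by (simp_all add: powr_mult_base minus_diff_commute)
      moreover have "(1 + t) powr s = (1 + t) * (1 + t) powr (s - 1)"
        using t by (simp add: powr_mult_base)
      moreover have "(2 * ((1 + t) * B - 1) * (s * B) * (t * T) + ((1 + t) * B - 1)\<^sup>2 * ((- 2 * s) * T)) / (2 * s)
          = ((1 + t) * B - 1) * T * (1 - B)" for B T
        using s by (simp add: field_simps power2_eq_square)
      ultimately show ?thesis by simp
    qed
    have "1 - \<delta> t = 1 / (1 + t)" using t by (simp add: \<delta>_def field_simps)
    then have "pos_powr s (1 - \<delta> t) = 1 / (1 + t) powr s"
      using t by (simp add: powr_divide)
    moreover have "\<delta> t powr (-1 - 2 * s) = t powr (-1 - 2 * s) * (1 + t) powr (1 + 2 * s)"
      using t by (simp add: \<delta>_def powr_divide powr_minus_divide[of "1 + t" "1 + 2 * s"] 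
         divide_powr_uminus field_simps flip: powr_minus)
    ultimately have "p (\<delta> t) * (1 / (1 + t)\<^sup>2)
        = ((1 + t) powr s - 1) * t powr (-1 - 2 * s) * ((1 + t) powr (1 + 2 * s) / ((1 + t) powr s * (1 + t)\<^sup>2))"
      using t by (simp add: p_def field_simps)
    also have "(1 + t) powr (1 + 2 * s) / ((1 + t) powr s * (1 + t)\<^sup>2)
        = (1 + t) powr (1 + 2 * s) / ((1 + t) powr s * (1 + t) powr 2)"
      using t by simp
    also have "\<dots> = (1 + t) powr (s - 1)"
      by (simp flip: powr_add powr_diff)
    finally have "p (\<delta> t) * (1 / (1 + t)\<^sup>2)
        + ((1 + t) powr s - 1) * t powr (-1 - 2 * s) * (1 - (1 + t) powr (s - 1)) = q t"
      by (simp add: q_def algebra_simps)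
    then show ?thesis
      unfolding \<Psi>_def using DERIV_add[OF 1 2] by simp
  qed

  have E_0: "(E \<longlongrightarrow> 0) (at_right 0)"
    unfolding E_def using s by real_asymp
  have E_inf: "(E \<longlongrightarrow> 1 / (2 * s)) at_top"
  proof -
    have "(E \<longlongrightarrow> inverse s / 2) at_top" unfolding E_def using s by real_asymp
    then show ?thesis by (simp add: field_simps)
  qed
  have "((\<lambda>t. R (\<delta> t)) \<longlongrightarrow> R 1) at_top"
  proof (rule isCont_tendsto_compose[of _ R])
    show "isCont R 1" using R[of 1] by (intro DERIV_isCont) auto
    show "(\<delta> \<longlongrightarrow> 1) at_top" unfolding \<delta>_def by real_asymp
  qed
  then have \<Psi>_inf: "(\<Psi> \<longlongrightarrow> R 1 + 1 / (2 * s)) at_top"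
    unfolding \<Psi>_def using E_inf by (rule tendsto_add)

  \<comment> \<open>Both \<open>R t\<close> and \<open>R (\<delta> t)\<close> may diverge at 0. Their difference is the integral of
    \<open>p\<close>, which is of order \<open>t powr (- 2 s)\<close> at most, over an interval of length \<open>t\<^sup>2 / (1 + t)\<close>, and \<open>2 - 2 s > 0\<close>.\<close>
  have R_0: "((\<lambda>t. R t - R (\<delta> t)) \<longlongrightarrow> 0) (at_right 0)"
  proof (rule tendsto_sandwich)
    have bd: "0 \<le> R t - R (\<delta> t) \<and> R t - R (\<delta> t) \<le> t\<^sup>2 / (1 + t) * (t / (1 + t)) powr (- 2 * s)"
      if t: "0 < t" "t < 1" for t
    proof -
      have \<delta>: "0 < \<delta> t" "\<delta> t < t" "t - \<delta> t = t\<^sup>2 / (1 + t)"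
        using t by (auto simp: \<delta>_def field_simps power2_eq_square)
      obtain c where c: "\<delta> t < c" "c < t" "R t - R (\<delta> t) = (t - \<delta> t) * p c"
        using MVT2[of "\<delta> t" t R p] \<delta> R by auto
      have "pos_powr s (1 - c) \<le> 1" using c t \<delta> s by (auto intro!: powr_le1)
      then have "0 \<le> p c" by (simp add: p_def)
      have "(1 - c) powr 1 \<le> (1 - c) powr s" using c t \<delta> s by (intro powr_mono') auto
      then have "1 - pos_powr s (1 - c) \<le> c" using c t \<delta> by simp
      then have "p c \<le> c * c powr (-1 - 2 * s)"
        unfolding p_def by (rule mult_right_mono) simp
      also have "\<dots> = c powr (- 2 * s)" using c \<delta> by (simp add: powr_mult_base)
      also have "\<dots> \<le> \<delta> t powr (- 2 * s)" using c \<delta> s by (intro powr_mono2') auto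
      finally have "(t - \<delta> t) * p c \<le> (t - \<delta> t) * \<delta> t powr (- 2 * s)"
        using \<delta> by (intro mult_left_mono) auto
      then show ?thesis using c \<delta> \<open>0 \<le> p c\<close> by (simp add: \<delta>_def)
    qed
    have ev: "\<forall>\<^sub>F t::real in at_right 0. 0 < t \<and> t < 1"
      by (auto simp: eventually_at_right_field intro: exI[of _ 1])
    show "\<forall>\<^sub>F t in at_right 0. 0 \<le> R t - R (\<delta> t)"
      using ev by eventually_elim (use bd in auto)
    show "\<forall>\<^sub>F t in at_right 0. R t - R (\<delta> t) \<le> t\<^sup>2 / (1 + t) * (t / (1 + t)) powr (- 2 * s)"
      using ev by eventually_elim (use bd in auto)
    show "((\<lambda>t::real. t\<^sup>2 / (1 + t) * (t / (1 + t)) powr (- 2 * s)) \<longlongrightarrow> 0) (at_right 0)"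
      using s by real_asymp
  qed simp

  define f where "f t = (2 * pos_powr s 1 - pos_powr s (1 + t) - pos_powr s (1 - t)) * t powr (-1 - 2 * s)" for t
  have f_eq: "f t = p t - q t" if "0 < t" for t
    using that by (simp add: f_def p_def q_def algebra_simps)

  have cont_R: "isCont R 1" and cont_\<Psi>: "isCont \<Psi> 1"
    using R[of 1] \<Psi>[of 1] by (auto intro: DERIV_isCont)

  have I1: "set_integrable lborel (einterval (ereal 0) (ereal 1)) (\<lambda>t. p t - q t) \<and> (LBINT t=ereal 0..ereal 1. p t - q t) = (R 1 - \<Psi> 1) - 0"
  proof (rule nonneg_FTC[where F="\<lambda>t. R t - \<Psi> t"])
    show "((\<lambda>t. R t - \<Psi> t) has_real_derivative p t - q t) (at t)" if "ereal 0 < ereal t" for t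
      using that by (intro DERIV_diff R \<Psi>) auto
    show "isCont (\<lambda>t. p t - q t) t" if "ereal 0 < ereal t" for t
      using that cont_p cont_q by (intro continuous_diff) auto
    have "0 \<le> p t - q t" if t: "0 < t" "t < 1" for t
    proof -
      have "p t - q t = (2 - (1 - t) powr s - (1 + t) powr s) * t powr (-1 - 2 * s)"
        using t by (simp add: p_def q_def algebra_simps)
      moreover have "(1 - t) powr s \<le> 1 + s * (- t)" "(1 + t) powr s \<le> 1 + s * t"
        using powr_le_tangent_at_1[OF s, of "1 - t"] powr_le_tangent_at_1[OF s, of "1 + t"] t by simp_all
      ultimately show ?thesis by simp
    qed
    then show "AE t in lborel. ereal 0 < ereal t \<longrightarrow> ereal t < ereal 1 \<longrightarrow> 0 \<le> p t - q t"
      by simp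
    have "((\<lambda>t. (R t - R (\<delta> t)) - E t) \<longlongrightarrow> 0 - 0) (at_right 0)"
      by (intro tendsto_diff R_0 E_0)
    then show "(((\<lambda>t. R t - \<Psi> t) \<circ> real_of_ereal) \<longlongrightarrow> 0) (at_right (ereal 0))"
      by (simp add: ereal_tendsto_simps1 \<Psi>_def diff_diff_eq)
    have "isCont (\<lambda>t. R t - \<Psi> t) 1" using cont_R cont_\<Psi> by (rule continuous_diff)
    then show "(((\<lambda>t. R t - \<Psi> t) \<circ> real_of_ereal) \<longlongrightarrow> R 1 - \<Psi> 1) (at_left (ereal 1))"
      by (simp add: ereal_tendsto_simps1 isCont_def filterlim_at_split)
  qed simp
  note I1 = conjunct1[OF I1] conjunct2[OF I1]
  have I2: "set_integrable lborel (einterval (ereal 1) \<infinity>) p \<and> (LBINT t=ereal 1..\<infinity>. p t) = 0 - (- 1 / (2 * s))"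
  proof (rule nonneg_FTC[where F="\<lambda>t. - (t powr (- 2 * s)) / (2 * s)"])
    show "((\<lambda>t. - (t powr (- 2 * s)) / (2 * s)) has_real_derivative p t) (at t)" if "ereal 1 < ereal t" for t
    proof -
      have "((\<lambda>t. - (t powr (- 2 * s)) / (2 * s)) has_real_derivative t powr (- 2 * s - 1)) (at t)"
        using that s by (auto intro!: derivative_eq_intros)
      then show ?thesis using that by (simp add: p_def minus_diff_commute)
    qed
    show "isCont p t" if "ereal 1 < ereal t" for t
      using that by (intro cont_p) auto
    show "AE t in lborel. ereal 1 < ereal t \<longrightarrow> ereal t < \<infinity> \<longrightarrow> 0 \<le> p t"
      by (auto simp: p_def)
    have "isCont (\<lambda>t. - (t powr (- 2 * s)) / (2 * s)) 1" using s by (intro continuous_intros) auto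
    then show "(((\<lambda>t. - (t powr (- 2 * s)) / (2 * s)) \<circ> real_of_ereal) \<longlongrightarrow> - 1 / (2 * s)) (at_right (ereal 1))"
      by (simp add: ereal_tendsto_simps1 isCont_def filterlim_at_split)
    show "(((\<lambda>t. - (t powr (- 2 * s)) / (2 * s)) \<circ> real_of_ereal) \<longlongrightarrow> 0) (at_left \<infinity>)"
      unfolding ereal_tendsto_simps1 using s by real_asymp
  qed simp
  note I2 = conjunct1[OF I2] conjunct2[OF I2]
  have I3: "set_integrable lborel (einterval (ereal 1) \<infinity>) q \<and> (LBINT t=ereal 1..\<infinity>. q t) = (R 1 + 1 / (2 * s)) - \<Psi> 1"
  proof (rule nonneg_FTC[where F=\<Psi>])
    show "(\<Psi> has_real_derivative q t) (at t)" if "ereal 1 < ereal t" for t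
      using that by (intro \<Psi>) auto
    show "isCont q t" if "ereal 1 < ereal t" for t
      using that by (intro cont_q) auto
    show "AE t in lborel. ereal 1 < ereal t \<longrightarrow> ereal t < \<infinity> \<longrightarrow> 0 \<le> q t"
      using s by (auto simp: q_def ge_one_powr_ge_zero)
    show "((\<Psi> \<circ> real_of_ereal) \<longlongrightarrow> \<Psi> 1) (at_right (ereal 1))"
      using cont_\<Psi> by (simp add: ereal_tendsto_simps1 isCont_def filterlim_at_split)
    show "((\<Psi> \<circ> real_of_ereal) \<longlongrightarrow> R 1 + 1 / (2 * s)) (at_left \<infinity>)"
      unfolding ereal_tendsto_simps1 by (rule \<Psi>_inf)
  qed simp
  note I3 = conjunct1[OF I3] conjunct2[OF I3]

  have A1: "set_integrable lborel {0<..<1} f" "(LBINT t:{0<..<1}. f t) = R 1 - \<Psi> 1"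
  proof -
    have "set_integrable lborel {0<..<1} f \<longleftrightarrow> set_integrable lborel {0<..<1} (\<lambda>t. p t - q t)"
      by (rule set_integrable_cong) (auto simp: f_eq)
    then show "set_integrable lborel {0<..<1} f" using I1(1) by simp
    have "(LBINT t:{0<..<1}. f t) = (LBINT t:{0<..<1}. p t - q t)"
      by (rule set_lebesgue_integral_cong) (auto simp: f_eq)
    then show "(LBINT t:{0<..<1}. f t) = R 1 - \<Psi> 1"
      using I1(2) by (simp add: interval_lebesgue_integral_def)
  qed
  have A2: "set_integrable lborel {1<..} f" "(LBINT t:{1<..}. f t) = \<Psi> 1 - R 1"
  proof -
    have pq: "set_integrable lborel {1<..} p" "set_integrable lborel {1<..} q"
      using I2(1) I3(1) by simp_all
    have "set_integrable lborel {1<..} f \<longleftrightarrow> set_integrable lborel {1<..} (\<lambda>t. p t - q t)"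
      by (rule set_integrable_cong) (auto simp: f_eq)
    then show "set_integrable lborel {1<..} f" using pq by simp
    have "(LBINT t:{1<..}. f t) = (LBINT t:{1<..}. p t - q t)"
      by (rule set_lebesgue_integral_cong) (auto simp: f_eq)
    also have "\<dots> = (LBINT t:{1<..}. p t) - (LBINT t:{1<..}. q t)"
      using pq by (rule set_integral_diff)
    finally show "(LBINT t:{1<..}. f t) = \<Psi> 1 - R 1"
      using I2(2) I3(2) by (simp add: interval_lebesgue_integral_def)
  qed
  have "{0<..<1} \<inter> {1::real<..} = {}" by auto
  then have "(LBINT t:({0<..<1} \<union> {1<..}). f t) = 0"
    using set_integral_Un[OF _ A1(1) A2(1)] A1(2) A2(2) by simp
  moreover have "set_integrable lborel ({0<..<1} \<union> {1<..}) f"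
    using A1 A2 by (intro set_integrable_Un) auto
  ultimately have split: "set_integrable lborel ({0<..<1} \<union> {1<..}) f"
      "(LBINT t:({0<..<1} \<union> {1<..}). f t) = 0"
    by simp_all
  have f_meas [measurable]: "f \<in> borel_measurable borel" unfolding f_def[abs_def] by simp
  have ae: "AE t in lborel. indicator ({0<..<1} \<union> {1<..}) t *\<^sub>R f t = indicator {0<..} t *\<^sub>R f t"
    by (rule AE_I[where N="{1}"]) (auto simp: indicator_def)
  have meas: "(\<lambda>t. indicator S t *\<^sub>R f t) \<in> borel_measurable lborel" if "S \<in> sets borel" for S
    using that by simp
  have "set_integrable lborel {0<..} f"
    unfolding set_integrable_def
    by (rule integrable_cong_AE_imp[OF split(1)[unfolded set_integrable_def] meas ae]) simp
  moreover have "(LBINT t:{0<..}. f t) = 0"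
    using split(2) integral_cong_AE[OF meas meas ae] unfolding set_lebesgue_integral_def by auto
  ultimately show ?thesis
    unfolding balanced_second_difference_def f_def by simp
qed

text \<open>The function is homogeneous, so the substitution \<open>t \<mapsto> x t\<close> reduces to the point 1.\<close>
lemma balanced_second_difference_pos_powr:
  assumes s: "0 < s" "s < 1" and x: "0 < x"
  shows "balanced_second_difference s (pos_powr s) x"
proof -
  define g where "g x t = indicator {0<..} t *\<^sub>R
    ((2 * pos_powr s x - pos_powr s (x + t) - pos_powr s (x - t)) * t powr (-1 - 2 * s))" for x t :: real
  have hom: "pos_powr s (x * t) = x powr s * pos_powr s t" for t
  proof -
    have "max 0 (x * t) = x * max 0 t" using x by (auto simp: max_def zero_le_mult_iff mult_le_0_iff)
    then show ?thesis using x by (simp add: powr_mult)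
  qed
  have "g x (0 + x * t) = x powr s * x powr (-1 - 2 * s) * g 1 t" for t
  proof (cases "0 < t")
    case True
    have "pos_powr s (x + x * t) = x powr s * pos_powr s (1 + t)"
         "pos_powr s (x - x * t) = x powr s * pos_powr s (1 - t)"
         "pos_powr s x = x powr s * pos_powr s 1"
      using hom[of "1 + t"] hom[of "1 - t"] hom[of 1] by (simp_all add: algebra_simps)
    then show ?thesis using True x by (simp add: g_def powr_mult algebra_simps)
  qed (use x in \<open>simp add: g_def zero_less_mult_iff\<close>)
  note g = this
  have "integrable lborel (g 1)" "integral\<^sup>L lborel (g 1) = 0"
    using balanced_second_difference_pos_powr_at_1[OF s]
    by (simp_all add: balanced_second_difference_def set_integrable_def set_lebesgue_integral_def g_def[abs_def])
  then have "integrable lborel (\<lambda>t. g x (0 + x * t))" "(\<integral>t. g x (0 + x * t) \<partial>lborel) = 0"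
    unfolding g by simp_all
  then have "integrable lborel (g x)" "integral\<^sup>L lborel (g x) = 0"
    using x lborel_integrable_real_affine_iff[of x "g x" 0] lborel_integral_real_affine[of x "g x" 0]
    by simp_all
  then show ?thesis
    by (simp add: balanced_second_difference_def set_integrable_def set_lebesgue_integral_def g_def[abs_def])
qed

section \<open>Odd solutions on symmetric intervals\<close>

lemma isCont_imp_tendsto_within: "isCont f x \<Longrightarrow> (f \<longlongrightarrow> f x) (at x within S)"
  unfolding isCont_def by (rule tendsto_within_subset[OF _ subset_UNIV])

definition odd_powr :: "real \<Rightarrow> real \<Rightarrow> real \<Rightarrow> real"
  where "odd_powr s A x = pos_powr s (A + x) - pos_powr s (A - x)"

lemma odd_powr_minus: "odd_powr s A (- x) = - odd_powr s A x"
  by (simp add: odd_powr_def)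

lemma borel_measurable_odd_powr [measurable]: "odd_powr s A \<in> borel_measurable borel"
  unfolding odd_powr_def[abs_def] by simp

lemma balanced_second_difference_odd_powr:
  assumes "0 < s" "s < 1" "\<bar>x\<bar> < A"
  shows "balanced_second_difference s (odd_powr s A) x"
proof -
  have "balanced_second_difference s (\<lambda>t. pos_powr s (A + t)) x"
    unfolding balanced_second_difference_translate[where \<phi>="pos_powr s"]
    using assms by (intro balanced_second_difference_pos_powr) auto
  moreover have "balanced_second_difference s (\<lambda>t. pos_powr s (A - t)) x"
    unfolding balanced_second_difference_reflect[where \<phi>="pos_powr s"]
    using assms by (intro balanced_second_difference_pos_powr) auto
  ultimately have "balanced_second_difference s (\<lambda>t. 1 * pos_powr s (A + t) + (-1) * pos_powr s (A - t)) x"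
    by (rule balanced_second_difference_linear)
  then show ?thesis by (simp add: odd_powr_def[abs_def])
qed

lemma abs_odd_powr_le:
  assumes s: "0 < s"
  shows "\<bar>odd_powr s A t\<bar> \<le> (1 + \<bar>A\<bar>) powr s * (1 + \<bar>t\<bar>) powr s"
proof -
  have le: "pos_powr s y \<le> (1 + \<bar>A\<bar>) powr s * (1 + \<bar>t\<bar>) powr s" if "\<bar>y\<bar> \<le> \<bar>A\<bar> + \<bar>t\<bar>" for y
  proof -
    have "\<bar>y\<bar> \<le> (1 + \<bar>A\<bar>) * (1 + \<bar>t\<bar>)"
      using that mult_nonneg_nonneg[of "\<bar>A\<bar>" "\<bar>t\<bar>"] by (simp add: algebra_simps del: mult_nonneg_nonneg)
    then have "pos_powr s y \<le> ((1 + \<bar>A\<bar>) * (1 + \<bar>t\<bar>)) powr s"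
      using s by (intro powr_mono2) auto
    then show ?thesis by (simp add: powr_mult)
  qed
  have "0 \<le> pos_powr s (A + t)" "0 \<le> pos_powr s (A - t)" by simp_all
  then show ?thesis
    using le[of "A + t"] le[of "A - t"] unfolding odd_powr_def by linarith
qed

lemma odd_powr_pos:
  assumes "0 < s" "0 < x" "x \<le> A"
  shows "0 < odd_powr s A x"
  unfolding odd_powr_def using assms powr_less_mono2[of s "A - x" "A + x"] by simp

definition odd_powr_deriv :: "real \<Rightarrow> real \<Rightarrow> real \<Rightarrow> real"
  where "odd_powr_deriv s A x = s * ((A + x) powr (s - 1) + (A - x) powr (s - 1))"

lemma odd_powr_has_derivative:
  assumes "\<bar>x\<bar> < A"
  shows "(odd_powr s A has_real_derivative odd_powr_deriv s A x) (at x)"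
proof -
  have "((\<lambda>x. (A + x) powr s - (A - x) powr s) has_real_derivative odd_powr_deriv s A x) (at x)"
    unfolding odd_powr_deriv_def using assms
    by (auto intro!: derivative_eq_intros simp: algebra_simps)
  moreover have "\<forall>\<^sub>F y in nhds x. (A + y) powr s - (A - y) powr s = odd_powr s A y"
  proof -
    have "\<forall>\<^sub>F y in nhds x. y \<in> {- A<..<A}"
      using assms by (intro eventually_nhds_in_open) auto
    then show ?thesis by eventually_elim (auto simp: odd_powr_def)
  qed
  ultimately show ?thesis by (subst (asm) DERIV_cong_ev[OF refl _ refl]) auto
qed

lemma isCont_odd_powr: "0 < s \<Longrightarrow> isCont (odd_powr s A) x"
  unfolding odd_powr_def[abs_def] by (intro continuous_intros) auto

lemma isCont_odd_powr_deriv: "\<bar>x\<bar> < A \<Longrightarrow> isCont (odd_powr_deriv s A) x"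
  unfolding odd_powr_deriv_def[abs_def] by (intro continuous_intros) auto

text \<open>The numerator of the derivative of the quotient of the two odd solutions for \<open>A\<close> and \<open>B\<close>.\<close>
definition odd_powr_wronskian :: "real \<Rightarrow> real \<Rightarrow> real \<Rightarrow> real \<Rightarrow> real"
  where "odd_powr_wronskian s A B x =
    odd_powr_deriv s A x * odd_powr s B x - odd_powr s A x * odd_powr_deriv s B x"

text \<open>Only the term \<open>(A - x) powr (s - 1)\<close> in the derivative of the first function is singular at \<open>A\<close>, and it is
  multiplied by a positive quantity.\<close>
lemma wronskian_at_top:
  assumes s: "0 < s" "s < 1" and AB: "0 < A" "A < B"
  shows "filterlim (odd_powr_wronskian s A B) at_top (at_left A)"
proof -
  have "filterlim (\<lambda>x. A - x) (at_right 0) (at_left A)"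
    by (rule filterlim_at_withinI) (auto intro!: tendsto_eq_intros simp: eventually_at_left_field intro: exI[of _ "A - 1"])
  moreover have "filterlim (\<lambda>y::real. y powr (s - 1)) at_top (at_right 0)"
    using s by real_asymp
  ultimately have "filterlim (\<lambda>x. (A - x) powr (s - 1)) at_top (at_left A)"
    by (rule filterlim_compose[rotated])
  moreover have "((\<lambda>x. (A + x) powr (s - 1)) \<longlongrightarrow> (A + A) powr (s - 1)) (at_left A)"
    using AB by (intro tendsto_intros) auto
  ultimately have "filterlim (\<lambda>x. (A + x) powr (s - 1) + (A - x) powr (s - 1)) at_top (at_left A)"
    by (intro filterlim_tendsto_add_at_top)
  then have "filterlim (odd_powr_deriv s A) at_top (at_left A)"
    unfolding odd_powr_deriv_def[abs_def] using s
    by (intro filterlim_tendsto_pos_mult_at_top[OF tendsto_const])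
  moreover have lim: "(odd_powr s D \<longlongrightarrow> odd_powr s D A) (at_left A)" for D
    using s(1) by (intro isCont_imp_tendsto_within isCont_odd_powr)
  ultimately have 1: "filterlim (\<lambda>x. odd_powr s B x * odd_powr_deriv s A x) at_top (at_left A)"
    using odd_powr_pos[of s A B] s AB by (intro filterlim_tendsto_pos_mult_at_top[OF lim]) auto
  have "(odd_powr_deriv s B \<longlongrightarrow> odd_powr_deriv s B A) (at_left A)"
    using AB by (intro isCont_imp_tendsto_within isCont_odd_powr_deriv) auto
  then have "((\<lambda>x. - (odd_powr s A x * odd_powr_deriv s B x)) \<longlongrightarrow> - (odd_powr s A A * odd_powr_deriv s B A)) (at_left A)"
    by (intro tendsto_intros lim)
  from filterlim_tendsto_add_at_top[OF this 1] show ?thesis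
    by (simp add: odd_powr_wronskian_def[abs_def] algebra_simps)
qed

section \<open>A combination that touches zero\<close>

lemma interior_minimum:
  fixes f :: "real \<Rightarrow> real"
  assumes "a < b" and cont: "\<And>x. a \<le> x \<Longrightarrow> x \<le> b \<Longrightarrow> isCont f x"
    and a: "(f has_real_derivative l) (at a)" "l < 0"
    and b: "(f has_real_derivative r) (at b)" "0 < r"
  obtains p y where "a < p" "p < b" "\<forall>x\<in>{a<..<b}. f p \<le> f x"
    "a < y" "y < b" "f p < f y"
proof -
  have "continuous_on {a..b} f"
    using cont by (intro continuous_at_imp_continuous_on) auto
  then obtain p where p: "a \<le> p" "p \<le> b" and min: "\<And>x. a \<le> x \<Longrightarrow> x \<le> b \<Longrightarrow> f p \<le> f x"
    using continuous_attains_inf[of "{a..b}" f] \<open>a < b\<close> by auto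
  obtain d where d: "0 < d" "\<And>h. 0 < h \<Longrightarrow> h < d \<Longrightarrow> f (a + h) < f a"
    using DERIV_neg_dec_right[OF a] by auto
  obtain e where e: "0 < e" "\<And>h. 0 < h \<Longrightarrow> h < e \<Longrightarrow> f (b - h) < f b"
    using DERIV_pos_inc_left[OF b] by auto
  have fa: "f p < f a"
  proof -
    define h where "h = min (d / 2) (b - a)"
    have "0 < h" "h < d" "a + h \<le> b" using d(1) \<open>a < b\<close> by (auto simp: h_def)
    then show ?thesis using d(2)[of h] min[of "a + h"] by linarith
  qed
  have fb: "f p < f b"
  proof -
    define h where "h = min (e / 2) (b - a)"
    have "0 < h" "h < e" "a \<le> b - h" using e(1) \<open>a < b\<close> by (auto simp: h_def)
    then show ?thesis using e(2)[of h] min[of "b - h"] by linarith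
  qed
  have "\<forall>\<^sub>F x in at_right a. f p < f x"
    using fa \<open>a < b\<close> by (intro order_tendstoD(1)[OF isCont_imp_tendsto_within] cont) auto
  moreover have "\<forall>\<^sub>F x in at_right a. x \<in> {a<..<b}"
    using \<open>a < b\<close> by (rule eventually_at_right_real)
  ultimately have "\<forall>\<^sub>F x in at_right a. f p < f x \<and> a < x \<and> x < b"
    by eventually_elim auto
  then obtain y where "f p < f y" "a < y" "y < b"
    using eventually_happens'[OF trivial_limit_at_right_real] by auto
  moreover have "a < p" "p < b" using p fa fb by (auto simp: less_le)
  moreover have "\<forall>x\<in>{a<..<b}. f p \<le> f x" using min by simp
  ultimately show ?thesis using that[of p y] by blast
qed

text \<open>The order of choices matters: \<open>x\<^sub>0\<close> close enough to 1 for the Wronskian of the solutions for 1 and 2 to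
  be positive, then \<open>A\<close> between \<open>x\<^sub>0\<close> and 1, then \<open>c\<close> so large that the quotient
  \<open>(w\<^sub>A + c w\<^sub>2) / w\<^sub>1\<close> decreases at \<open>x\<^sub>0\<close>, and at last \<open>x\<^sub>1\<close> so close to \<open>A\<close> that it increases there.\<close>
lemma exists_touching_combination:
  fixes s :: real
  assumes s: "0 < s" "s < 1"
  obtains A c m x0 x1 p y where
    "0 < x0" "x0 < x1" "x1 < A" "A < 1"
    "\<forall>x\<in>{x0<..<x1}. 0 \<le> odd_powr s A x + c * odd_powr s 2 x - m * odd_powr s 1 x"
    "x0 < p" "p < x1" "odd_powr s A p + c * odd_powr s 2 p - m * odd_powr s 1 p = 0"
    "x0 < y" "y < x1" "odd_powr s A y + c * odd_powr s 2 y - m * odd_powr s 1 y \<noteq> 0"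
proof -
  let ?N = "odd_powr_wronskian s"
  have "\<forall>\<^sub>F x in at_left 1. 0 < ?N 1 2 x \<and> x \<in> {0<..<1}"
    using filterlim_at_top_dense[THEN iffD1, OF wronskian_at_top[OF s, of 1 2]]
    by (intro eventually_conj eventually_at_left_real) auto
  then obtain x0 where x0: "0 < x0" "x0 < 1" "0 < ?N 1 2 x0"
    using eventually_happens'[OF trivial_limit_at_left_real] by auto
  define A where "A = (x0 + 1) / 2"
  have A: "x0 < A" "A < 1" "0 < A" using x0 by (auto simp: A_def)
  define c where "c = (\<bar>?N A 1 x0\<bar> + 1) / ?N 1 2 x0"
  have "c * ?N 1 2 x0 = \<bar>?N A 1 x0\<bar> + 1" using x0 by (simp add: c_def)
  then have neg: "?N A 1 x0 - c * ?N 1 2 x0 < 0" by linarith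
  have "isCont (?N 1 2) A"
    unfolding odd_powr_wronskian_def[abs_def] using A s
    by (intro continuous_intros isCont_odd_powr isCont_odd_powr_deriv) auto
  then have "((\<lambda>x. - (c * ?N 1 2 x)) \<longlongrightarrow> - (c * ?N 1 2 A)) (at_left A)"
    by (intro tendsto_intros isCont_imp_tendsto_within)
  from filterlim_tendsto_add_at_top[OF this wronskian_at_top[OF s A(3) A(2)]]
  have "\<forall>\<^sub>F x in at_left A. 0 < - (c * ?N 1 2 x) + ?N A 1 x"
    by (simp only: filterlim_at_top_dense)
  then have "\<forall>\<^sub>F x in at_left A. 0 < - (c * ?N 1 2 x) + ?N A 1 x \<and> x \<in> {x0<..<A}"
    using A by (intro eventually_conj eventually_at_left_real) auto
  then obtain x1 where x1: "x0 < x1" "x1 < A" "0 < ?N A 1 x1 - c * ?N 1 2 x1"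
    using eventually_happens'[OF trivial_limit_at_left_real] by fastforce

  \<comment> \<open>The numerator of the derivative of this quotient is the Wronskian for \<open>A\<close> and 1 minus \<open>c\<close> times the one
    for 1 and 2.\<close>
  define f where "f x = (odd_powr s A x + c * odd_powr s 2 x) / odd_powr s 1 x" for x
  have pos: "0 < odd_powr s 1 x" if "x0 \<le> x" "x \<le> x1" for x
    using that x0 x1 A s by (intro odd_powr_pos) auto
  have f': "(f has_real_derivative (?N A 1 x - c * ?N 1 2 x) / (odd_powr s 1 x)\<^sup>2) (at x)"
    if x: "x0 \<le> x" "x \<le> x1" for x
    unfolding f_def odd_powr_wronskian_def using pos[OF x] x x0 x1 A
    by (auto intro!: derivative_eq_intros odd_powr_has_derivative simp: power2_eq_square algebra_simps)
  have cont: "isCont f x" if "x0 \<le> x" "x \<le> x1" for x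
    using f'[OF that] by (rule DERIV_isCont)
  have slope0: "(?N A 1 x0 - c * ?N 1 2 x0) / (odd_powr s 1 x0)\<^sup>2 < 0"
    using neg pos[of x0] x1 by (intro divide_neg_pos) auto
  have slope1: "0 < (?N A 1 x1 - c * ?N 1 2 x1) / (odd_powr s 1 x1)\<^sup>2"
    using pos[of x1] x1 by (intro divide_pos_pos) auto
  have "x0 \<le> x0" "x0 \<le> x1" "x1 \<le> x1" using x1 by auto
  note deriv = f'[OF this(1,2)] f'[OF this(2,3)]
  obtain p y where p: "x0 < p" "p < x1" "\<forall>x\<in>{x0<..<x1}. f p \<le> f x"
    and y: "x0 < y" "y < x1" "f p < f y"
    using interior_minimum[OF x1(1) cont deriv(1) slope0 deriv(2) slope1] by blast
  have eq: "odd_powr s A x + c * odd_powr s 2 x - f p * odd_powr s 1 x = (f x - f p) * odd_powr s 1 x"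
    if "x0 < x" "x < x1" for x
  proof -
    have "f x * odd_powr s 1 x = odd_powr s A x + c * odd_powr s 2 x"
      using pos[of x] that by (simp add: f_def)
    then show ?thesis by (simp add: left_diff_distrib)
  qed
  show ?thesis
  proof (rule that[of x0 x1 A c "f p" p y])
    show "\<forall>x\<in>{x0<..<x1}. 0 \<le> odd_powr s A x + c * odd_powr s 2 x - f p * odd_powr s 1 x"
    proof
      fix x assume x: "x \<in> {x0<..<x1}"
      then have "0 \<le> (f x - f p) * odd_powr s 1 x"
        using p(3) pos[of x] by (intro mult_nonneg_nonneg) (simp_all add: less_imp_le)
      then show "0 \<le> odd_powr s A x + c * odd_powr s 2 x - f p * odd_powr s 1 x"
        using eq[of x] x by simp
    qed
    show "odd_powr s A y + c * odd_powr s 2 y - f p * odd_powr s 1 y \<noteq> 0"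
      unfolding eq[OF y(1,2)] using y pos[of y] by simp
    show "odd_powr s A p + c * odd_powr s 2 p - f p * odd_powr s 1 p = 0"
      unfolding eq[OF p(1,2)] by simp
  qed (use x0 x1 A p y in auto)
qed

theorem corollary1p3:
  fixes s :: real and k :: "'n::finite"
  assumes "0 < s" and "s < 1"
  shows "\<exists>(\<Omega> :: (real ^ 'n) set) (u :: real ^ 'n \<Rightarrow> real).
    bounded \<Omega> \<and> open \<Omega> \<and> \<Omega> \<subseteq> half_space k \<and>
    antisymmetric k u \<and>
    (\<forall>x\<in>\<Omega>. u x \<ge> 0) \<and> s_harmonic_on s u \<Omega> \<and>
    (\<exists>x\<in>\<Omega>. u x = 0) \<and>
    \<not> (\<forall>x\<in>\<Omega>. u x = 0)"
proof (rule exists_touching_combination[OF assms])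
  fix A c m x0 x1 p y :: real
  assume x: "0 < x0" "x0 < x1" "x1 < A" "A < 1"
    and nonneg: "\<forall>x\<in>{x0<..<x1}. 0 \<le> odd_powr s A x + c * odd_powr s 2 x - m * odd_powr s 1 x"
    and p: "x0 < p" "p < x1" "odd_powr s A p + c * odd_powr s 2 p - m * odd_powr s 1 p = 0"
    and y: "x0 < y" "y < x1" "odd_powr s A y + c * odd_powr s 2 y - m * odd_powr s 1 y \<noteq> 0"
  define \<phi> where "\<phi> t = odd_powr s A t + c * odd_powr s 2 t - m * odd_powr s 1 t" for t
  define u where "u z = \<phi> (z $ k)" for z :: "real^'n"
  define \<Omega> where "\<Omega> = ball 0 1 \<inter> {z::real^'n. x0 < z $ k} \<inter> {z. z $ k < x1}"
  have \<phi>_meas [measurable]: "\<phi> \<in> borel_measurable borel"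
    unfolding \<phi>_def[abs_def] by simp
  define C where "C = (1 + \<bar>A\<bar>) powr s + \<bar>c\<bar> * (1 + \<bar>2\<bar>) powr s + \<bar>m\<bar> * (1 + \<bar>1\<bar>) powr s"
  have growth: "\<bar>\<phi> t\<bar> \<le> C * (1 + \<bar>t\<bar>) powr s" for t
  proof -
    have "\<bar>a * odd_powr s D t\<bar> \<le> \<bar>a\<bar> * (1 + \<bar>D\<bar>) powr s * (1 + \<bar>t\<bar>) powr s" for a D
      using mult_left_mono[OF abs_odd_powr_le[OF assms(1), of D t], of "\<bar>a\<bar>"] by (simp add: abs_mult)
    from this[of 1 A] this[of c 2] this[of m 1] show ?thesis
      unfolding \<phi>_def C_def distrib_right by linarith
  qed
  have "balanced_second_difference s \<phi> t" if "x0 < t" "t < x1" for t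
  proof -
    have "balanced_second_difference s (\<lambda>t. 1 * (1 * odd_powr s A t + c * odd_powr s 2 t) + (- m) * odd_powr s 1 t) t"
      using that x assms
      by (intro balanced_second_difference_linear balanced_second_difference_odd_powr) auto
    then show ?thesis by (simp add: \<phi>_def[abs_def])
  qed
  then have "frac_laplacian_defined s u z \<and> frac_laplacian s u z = 0" if "z \<in> \<Omega>" for z
    using that s_harmonic_at_component[OF assms(1) \<phi>_meas growth, of z k] unfolding u_def[abs_def] \<Omega>_def by auto
  moreover have "u \<in> borel_measurable lebesgue"
    unfolding u_def[abs_def] by (intro measurable_completion) simp
  ultimately have "s_harmonic_on s u \<Omega>" by (simp add: s_harmonic_on_def)
  moreover have "bounded \<Omega>" unfolding \<Omega>_def by (intro bounded_Int disjI1) auto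
  moreover have "open \<Omega>" unfolding \<Omega>_def
    by (intro open_Int open_ball open_Collect_less continuous_intros)
  moreover have "\<Omega> \<subseteq> half_space k" using x by (auto simp: \<Omega>_def half_space_def)
  moreover have "antisymmetric k u"
    by (simp add: antisymmetric_def u_def reflect_def \<phi>_def odd_powr_minus)
  moreover have "\<forall>z\<in>\<Omega>. 0 \<le> u z" using nonneg by (auto simp: \<Omega>_def u_def \<phi>_def)
  moreover have mem: "axis k t \<in> \<Omega>" "u (axis k t) = \<phi> t" if "x0 < t" "t < x1" for t
    using that x by (auto simp: \<Omega>_def u_def norm_eq_sqrt_inner inner_axis_axis)
  moreover have "\<exists>z\<in>\<Omega>. u z = 0" using mem[OF p(1,2)] p(3) by (auto simp: \<phi>_def)
  moreover have "\<not> (\<forall>z\<in>\<Omega>. u z = 0)"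
  proof -
    have "u (axis k y) \<noteq> 0" using mem(2)[OF y(1,2)] y(3) by (simp add: \<phi>_def)
    then show ?thesis using mem(1)[OF y(1,2)] by blast
  qed
  ultimately show ?thesis by blast
qed

end
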